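(* Let $c(r)=\sigma^2c_0(r)$, $r\in[0,\pi]$, with $\sigma^2>0$, where $c_0$ is any of the ten isotropic correlation functions on $\mathbb S^d$ listed in the context (powered exponential, Matérn, generalized Cauchy, Dagum, multiquadric, sine power, spherical, Askey, $C^2$-Wendland, $C^4$-Wendland), with parameters in the range specified there and with $d$ in the range specified there for that model. Let $\mathbf Y_0=\{\mathbf Y_0(u):u\in\mathbb S^d\}$ be a mean-zero Gaussian random field with covariance function $\mathbb E[\mathbf Y_0(u)\mathbf Y_0(v)]=c(d(u,v))$, and let $\gamma(u,v)=\mathbb E[(\mathbf Y_0(u)-\mathbf Y_0(v))^2]/2=c(0)-c(d(u,v))$ be its variogram. Then there exist $s\in(0,1]$, $\ell\in(0,1)$ and $m>0$ such that $$\gamma(u,v)\le m\,d(u,v)^{\ell/2}\qquad\text{whenever } u,v\in\mathbb S^d\text{ and } d(u,v)<s.$$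
   Context: $\mathbb S^d=\{x\in\mathbb R^{d+1}:\|x\|=1\}$ is the $d$-dimensional unit sphere, and $d(u,v)=\arccos(\langle u,v\rangle)\in[0,\pi]$ is the geodesic distance (the symbol $d$ without arguments is the dimension). A Gaussian random field on $\mathbb S^d$ is a family $\{\mathbf Y(u):u\in\mathbb S^d\}$ of real random variables all of whose finite linear combinations are normally distributed. Notation: $\Gamma$ is the gamma function, $K_\nu$ is the modified Bessel function of the second kind, and $t_+=\max\{t,0\}$ for $t\in\mathbb R$. The correlation functions $c_0(r)$, $0\le r\le\pi$ (with $c_0(0)=1$, understood as the limit at $r=0$ where needed), and their parameter ranges are: 1. Powered exponential: $c_0(r)=\exp(-r^\alpha/\phi)$, $\alpha\in(0,1]$, $\phi>0$. 2. Matérn: $c_0(r)=\frac{2}{\Gamma(\nu)}\left(\frac{r}{2\phi}\right)^\nu K_\nu\left(\frac r\phi\right)$, $0<\nu\le\frac12$, $\phi>0$. 3. Generalized Cauchy: $c_0(r)=\left(1+\left(\frac r\phi\right)^\alpha\right)^{-\tau/\alpha}$, $\phi>0$, $\alpha\in(0,1]$, $\tau>0$. 4. Dagum: $c_0(r)=1-\left(\frac{(r/\phi)^\tau}{1+(r/\phi)^\tau}\right)^{\alpha/\tau}$, $\phi>0$, $\tau\in(0,1]$, $\alpha\in(0,\tau)$. 5. Multiquadric: $c_0(r)=\left(\frac{(1-\delta)^2}{1+\delta^2-2\delta\cos r}\right)^\tau$, $\delta\in(0,1)$, $\tau>0$. 6. Sine power: $c_0(r)=1-\sin(r/2)^\alpha$,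 $\alpha\in(0,2)$. 7. Spherical: $c_0(r)=\left(1+\frac12\frac r\phi\right)\left(1-\frac r\phi\right)_+^2$, $\phi>0$. 8. Askey: $c_0(r)=\left(1-\frac r\phi\right)_+^\tau$, $\phi>0$, $\tau\ge2$. 9. $C^2$-Wendland: $c_0(r)=\left(1+\tau\frac r\phi\right)\left(1-\frac r\phi\right)_+^\tau$, $\phi\in(0,\pi]$, $\tau\ge4$. 10. $C^4$-Wendland: $c_0(r)=\left(1+\tau\frac r\phi+\frac{\tau^2-1}{3}\frac{r^2}{\phi^2}\right)\left(1-\frac r\phi\right)_+^\tau$, $\phi\in(0,\pi]$, $\tau\ge6$. For models 1–6, $d\in\{1,2,\ldots\}$; for models 7–10, $d\in\{1,2,3\}$. For these ranges it is known (Gneiting, 2013) that $\sigma^2c_0(d(u,v))$ is a covariance function on $\mathbb S^d$ for every $\sigma^2>0$. *)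

theory Defs
  imports "HOL-Probability.Probability"
begin

definition geodesic_dist :: "real ^ 'n \<Rightarrow> real ^ 'n \<Rightarrow> real" where
  "geodesic_dist u v = arccos (u \<bullet> v)"

text \<open>The degenerate normal laws (point masses) are included: the linear combination with
  all coefficients zero is constant, and the covariance of a field may be singular.\<close>

definition normally_distributed :: "'a measure \<Rightarrow> ('a \<Rightarrow> real) \<Rightarrow> bool" where
  "normally_distributed M X \<longleftrightarrow>
     X \<in> borel_measurable M \<and>
     (\<exists>\<mu>. (AE \<omega> in M. X \<omega> = \<mu>) \<or>
          (\<exists>\<sigma>>0. distributed M lborel X (\<lambda>x. ennreal (normal_density \<mu> \<sigma> x))))"

definition gaussian_field :: "'a measure \<Rightarrow> 'i set \<Rightarrow> ('i \<Rightarrow> 'a \<Rightarrow> real) \<Rightarrow> bool" where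
  "gaussian_field M T Y \<longleftrightarrow>
     prob_space M \<and>
     (\<forall>F a. finite F \<longrightarrow> F \<subseteq> T \<longrightarrow> normally_distributed M (\<lambda>\<omega>. \<Sum>u\<in>F. a u * Y u \<omega>))"

definition variogram :: "'a measure \<Rightarrow> ('i \<Rightarrow> 'a \<Rightarrow> real) \<Rightarrow> 'i \<Rightarrow> 'i \<Rightarrow> real" where
  "variogram M Y u v = (\<integral>\<omega>. (Y u \<omega> - Y v \<omega>)\<^sup>2 \<partial>M) / 2"

text \<open>Modified Bessel functions of real order on \<open>x > 0\<close>. The reciprocal gamma function
  vanishes at the poles of the gamma function, as the series requires.\<close>

definition bessel_I :: "real \<Rightarrow> real \<Rightarrow> real" where
  "bessel_I \<nu> x = (\<Sum>k. (x / 2) powr (2 * real k + \<nu>) * rGamma (real k + \<nu> + 1) / fact k)"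

definition bessel_K :: "real \<Rightarrow> real \<Rightarrow> real" where
  "bessel_K \<nu> x =
     (let q = (\<lambda>\<mu>. pi / 2 * (bessel_I (- \<mu>) x - bessel_I \<mu> x) / sin (\<mu> * pi))
      in if \<nu> \<in> \<int> then Lim (at \<nu>) q else q \<nu>)"

datatype correlation_model =
    Powered_Exponential (alpha: real) (phi: real)
  | Matern (nu: real) (phi: real)
  | Generalized_Cauchy (alpha: real) (tau: real) (phi: real)
  | Dagum (alpha: real) (tau: real) (phi: real)
  | Multiquadric (delta: real) (tau: real)
  | Sine_Power (alpha: real)
  | Spherical (phi: real)
  | Askey (tau: real) (phi: real)
  | C2_Wendland (tau: real) (phi: real)
  | C4_Wendland (tau: real) (phi: real)

text \<open>Since \<open>0 powr a = 0\<close>, every formula except the one for the Matern model already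
  has the value \<open>1\<close> at \<open>r = 0\<close>; there the limit has to be put in explicitly.\<close>

fun correlation :: "correlation_model \<Rightarrow> real \<Rightarrow> real" where
  "correlation (Powered_Exponential \<alpha> \<phi>) r = exp (- (r powr \<alpha>) / \<phi>)"
| "correlation (Matern \<nu> \<phi>) r =
     (if r = 0 then 1 else 2 / Gamma \<nu> * (r / (2 * \<phi>)) powr \<nu> * bessel_K \<nu> (r / \<phi>))"
| "correlation (Generalized_Cauchy \<alpha> \<tau> \<phi>) r = (1 + (r / \<phi>) powr \<alpha>) powr (- \<tau> / \<alpha>)"
| "correlation (Dagum \<alpha> \<tau> \<phi>) r =
     1 - ((r / \<phi>) powr \<tau> / (1 + (r / \<phi>) powr \<tau>)) powr (\<alpha> / \<tau>)"
| "correlation (Multiquadric \<delta> \<tau>) r =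
     ((1 - \<delta>)\<^sup>2 / (1 + \<delta>\<^sup>2 - 2 * \<delta> * cos r)) powr \<tau>"
| "correlation (Sine_Power \<alpha>) r = 1 - sin (r / 2) powr \<alpha>"
| "correlation (Spherical \<phi>) r = (1 + r / \<phi> / 2) * (max (1 - r / \<phi>) 0)\<^sup>2"
| "correlation (Askey \<tau> \<phi>) r = max (1 - r / \<phi>) 0 powr \<tau>"
| "correlation (C2_Wendland \<tau> \<phi>) r = (1 + \<tau> * r / \<phi>) * max (1 - r / \<phi>) 0 powr \<tau>"
| "correlation (C4_Wendland \<tau> \<phi>) r =
     (1 + \<tau> * r / \<phi> + (\<tau>\<^sup>2 - 1) / 3 * (r\<^sup>2 / \<phi>\<^sup>2)) * max (1 - r / \<phi>) 0 powr \<tau>"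

fun params_in_range :: "correlation_model \<Rightarrow> bool" where
  "params_in_range (Powered_Exponential \<alpha> \<phi>) \<longleftrightarrow> \<alpha> \<in> {0<..1} \<and> \<phi> > 0"
| "params_in_range (Matern \<nu> \<phi>) \<longleftrightarrow> \<nu> \<in> {0<..1/2} \<and> \<phi> > 0"
| "params_in_range (Generalized_Cauchy \<alpha> \<tau> \<phi>) \<longleftrightarrow> \<alpha> \<in> {0<..1} \<and> \<tau> > 0 \<and> \<phi> > 0"
| "params_in_range (Dagum \<alpha> \<tau> \<phi>) \<longleftrightarrow> \<tau> \<in> {0<..1} \<and> \<alpha> \<in> {0<..<\<tau>} \<and> \<phi> > 0"
| "params_in_range (Multiquadric \<delta> \<tau>) \<longleftrightarrow> \<delta> \<in> {0<..<1} \<and> \<tau> > 0"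
| "params_in_range (Sine_Power \<alpha>) \<longleftrightarrow> \<alpha> \<in> {0<..<2}"
| "params_in_range (Spherical \<phi>) \<longleftrightarrow> \<phi> > 0"
| "params_in_range (Askey \<tau> \<phi>) \<longleftrightarrow> \<tau> \<ge> 2 \<and> \<phi> > 0"
| "params_in_range (C2_Wendland \<tau> \<phi>) \<longleftrightarrow> \<tau> \<ge> 4 \<and> \<phi> \<in> {0<..pi}"
| "params_in_range (C4_Wendland \<tau> \<phi>) \<longleftrightarrow> \<tau> \<ge> 6 \<and> \<phi> \<in> {0<..pi}"

fun dims :: "correlation_model \<Rightarrow> nat set" where
  "dims (Spherical \<phi>) = {1..3}"
| "dims (Askey \<tau> \<phi>) = {1..3}"
| "dims (C2_Wendland \<tau> \<phi>) = {1..3}"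
| "dims (C4_Wendland \<tau> \<phi>) = {1..3}"
| "dims _ = {1..}"

lemma correlation_0: "params_in_range p \<Longrightarrow> correlation p 0 = 1"
proof (cases p)
  case (Multiquadric \<delta> \<tau>)
  assume "params_in_range p"
  moreover have "1 + \<delta>\<^sup>2 - 2 * \<delta> = (1 - \<delta>)\<^sup>2"
    by (simp add: power2_eq_square algebra_simps)
  ultimately show ?thesis
    using Multiquadric by simp
qed auto

end

theory Submission
  imports Defs
begin

text \<open>
  The field enters only through its covariance: expanding the square gives
  \<open>\<gamma>(u,v) = \<sigma>\<^sup>2 (1 - c\<^sub>0(d(u,v)))\<close>. So everything reduces to a one-variable question: does
  \<open>1 - c\<^sub>0(r) \<le> C r\<^sup>H\<close> hold on \<open>[0,1)\<close> for some exponent \<open>H > 0\<close>? Such a bound may then be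
  weakened to any smaller exponent because \<open>r < 1\<close>, and \<open>l = min H (1/2)\<close> gives
  \<open>l / 2 \<le> H\<close> and \<open>l < 1\<close>.

  For the Dagum and sine power models the bound follows from monotonicity of the power function.
  For the others except the Matern one it comes from convexity, in the form of
  \<open>exp (- x) \<ge> 1 - x\<close> and of the Bernoulli inequalities \<open>(1 + x) powr - a \<ge> 1 - a x\<close> and
  \<open>(1 - x) powr a \<ge> 1 - a x\<close>. The exponent \<open>H\<close> is \<open>\<alpha>\<close> for the powered exponential,
  generalized Cauchy, Dagum and sine power models, \<open>1\<close> for the compactly supported models,
  and \<open>2\<close> for the multiquadric model.

  For the Matern model the reflection formula \<open>\<Gamma>(\<nu>) \<Gamma>(1 - \<nu>) = \<pi> / sin (\<pi> \<nu>)\<close> turns the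
  correlation function into \<open>\<Gamma>(1 - \<nu>) (x/2)\<^sup>\<nu> (I\<^sub>-\<^sub>\<nu>(x) - I\<^sub>\<nu>(x))\<close> with \<open>x = r / \<phi>\<close>. All terms of
  the Bessel series are nonnegative, so \<open>I\<^sub>-\<^sub>\<nu>\<close> is at least its leading term, which
  contributes exactly \<open>1\<close>; and \<open>I\<^sub>\<nu>(x)\<close> is at most a constant times \<open>(x/2)\<^sup>\<nu>\<close>, which leaves
  an error of order \<open>r powr (2 \<nu>)\<close>.
\<close>

section \<open>Bernoulli inequalities for real exponents\<close>

lemma one_plus_powr_minus_ge:
  fixes a x :: real
  assumes "a \<ge> 0" "x \<ge> 0"
  shows "1 - a * x \<le> (1 + x) powr (- a)"
proof -
  have "a * ln (1 + x) \<le> a * x"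
    using assms ln_add_one_self_le_self by (intro mult_left_mono) auto
  moreover have "1 + - a * ln (1 + x) \<le> exp (- a * ln (1 + x))"
    by (rule exp_ge_add_one_self)
  ultimately show ?thesis
    using assms by (simp add: powr_def)
qed

text \<open>The curve \<open>w\<^sup>a\<close> lies above its tangent at \<open>w = 1\<close>; this is Young's inequality with one
  factor equal to \<open>1\<close>.\<close>

lemma one_minus_powr_ge:
  fixes a x :: real
  assumes "a \<ge> 1"
  shows "1 - a * x \<le> max (1 - x) 0 powr a"
proof (cases "a = 1")
  case False
  define w where "w = max (1 - x) 0"
  have "w * 1 \<le> w powr a / a + 1 powr (a / (a - 1)) / (a / (a - 1))"
    using assms False by (intro Youngs_inequality) (auto simp: w_def field_simps)
  then have "w \<le> (w powr a + (a - 1)) / a"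
    using assms False by (simp add: add_divide_distrib)
  then have "a * w \<le> w powr a + (a - 1)"
    using assms by (simp add: pos_le_divide_eq mult.commute)
  moreover have "a * (1 - x) \<le> a * w"
    using assms by (intro mult_left_mono) (auto simp: w_def)
  ultimately show ?thesis
    by (simp add: w_def algebra_simps)
qed auto

section \<open>The modified Bessel functions near the origin\<close>

text \<open>Each step of the recurrence \<open>\<Gamma>(a + 1) = a \<Gamma>(a)\<close> from \<open>a\<close> upwards gains a factor of at
  least \<open>a\<close>. This makes the Bessel series smaller, term by term, than an exponential series.\<close>

lemma rGamma_add_nat_le:
  fixes a :: real
  assumes "a > 0"
  shows "rGamma (a + real k) \<le> rGamma a / a ^ k"
proof (induction k)
  case (Suc k)
  have pos: "rGamma (a + real (Suc k)) \<ge> 0"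
    using assms by (simp add: rGamma_inverse_Gamma less_imp_le)
  have "a * rGamma (a + real (Suc k)) \<le> (a + real k) * rGamma (a + real k + 1)"
    using pos by (auto intro!: mult_mono simp: assms less_imp_le add_ac)
  also have "\<dots> = rGamma (a + real k)"
    by (rule rGamma_plus1)
  also note Suc.IH
  finally show ?case
    using assms by (simp add: field_simps)
qed simp

lemma bessel_I_term_bounds:
  fixes \<mu> x :: real
  assumes "\<mu> > - 1" "x > 0"
  defines "t \<equiv> \<lambda>k. (x / 2) powr (2 * real k + \<mu>) * rGamma (real k + \<mu> + 1) / fact k"
  shows "t k \<ge> 0"
    and "t k \<le> (x / 2) powr \<mu> * rGamma (\<mu> + 1) * ((x\<^sup>2 / (4 * (\<mu> + 1))) ^ k / fact k)"
proof -
  have "rGamma (real k + \<mu> + 1) \<ge> 0"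
    using assms by (simp add: rGamma_inverse_Gamma less_imp_le)
  then show "t k \<ge> 0"
    unfolding t_def by simp
  have "rGamma (real k + \<mu> + 1) \<le> rGamma (\<mu> + 1) / (\<mu> + 1) ^ k"
    using rGamma_add_nat_le[of "\<mu> + 1" k] assms by (simp add: add_ac)
  moreover have "(x / 2) powr (2 * real k + \<mu>) = (x / 2) powr \<mu> * (x\<^sup>2 / 4) ^ k"
  proof -
    have "(x / 2) powr (2 * real k) = (x / 2) ^ (2 * k)"
      using assms powr_realpow[of "x / 2" "2 * k"] by simp
    also have "\<dots> = (x\<^sup>2 / 4) ^ k"
      by (simp add: power_mult power_divide)
    finally show ?thesis
      using assms by (simp add: powr_add)
  qed
  ultimately have "t k \<le> (x / 2) powr \<mu> * (x\<^sup>2 / 4) ^ k * (rGamma (\<mu> + 1) / (\<mu> + 1) ^ k) / fact k"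
    unfolding t_def by (simp only:) (intro divide_right_mono mult_left_mono, auto)
  moreover have "(x\<^sup>2 / (4 * (\<mu> + 1))) ^ k = (x\<^sup>2 / 4) ^ k / (\<mu> + 1) ^ k"
    by (simp only: divide_divide_eq_left flip: power_divide)
  ultimately show "t k \<le> (x / 2) powr \<mu> * rGamma (\<mu> + 1) * ((x\<^sup>2 / (4 * (\<mu> + 1))) ^ k / fact k)"
    by (simp only: mult_ac times_divide_eq_right times_divide_eq_left divide_divide_eq_left)
qed

text \<open>The lower bound is the leading term of the series; the upper bound is the sum of the
  exponential majorant.\<close>

lemma bessel_I_bounds:
  fixes \<mu> x :: real
  assumes "\<mu> > - 1" "x > 0"
  shows "(x / 2) powr \<mu> * rGamma (\<mu> + 1) \<le> bessel_I \<mu> x"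
    and "bessel_I \<mu> x \<le> (x / 2) powr \<mu> * rGamma (\<mu> + 1) * exp (x\<^sup>2 / (4 * (\<mu> + 1)))"
proof -
  define t where "t = (\<lambda>k. (x / 2) powr (2 * real k + \<mu>) * rGamma (real k + \<mu> + 1) / fact k)"
  define b where "b = (\<lambda>k. (x / 2) powr \<mu> * rGamma (\<mu> + 1) * ((x\<^sup>2 / (4 * (\<mu> + 1))) ^ k / fact k))"
  have t0: "t k \<ge> 0" and tb: "t k \<le> b k" for k
    unfolding t_def b_def by (rule bessel_I_term_bounds[OF assms])+
  have b: "b sums ((x / 2) powr \<mu> * rGamma (\<mu> + 1) * exp (x\<^sup>2 / (4 * (\<mu> + 1))))"
    unfolding b_def
    using exp_converges[of "x\<^sup>2 / (4 * (\<mu> + 1))"]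
    by (intro sums_mult) (simp add: divide_inverse mult_ac)
  have summable: "summable t"
    using t0 tb by (intro summable_comparison_test'[OF sums_summable[OF b], of 0]) auto
  have I: "bessel_I \<mu> x = suminf t"
    unfolding bessel_I_def t_def ..
  show "bessel_I \<mu> x \<le> (x / 2) powr \<mu> * rGamma (\<mu> + 1) * exp (x\<^sup>2 / (4 * (\<mu> + 1)))"
    unfolding I sums_unique[OF b] using tb summable b by (intro suminf_le) (auto simp: sums_iff)
  have "t 0 \<le> suminf t"
    using sum_le_suminf[OF summable, of "{0}"] t0 by simp
  then show "(x / 2) powr \<mu> * rGamma (\<mu> + 1) \<le> bessel_I \<mu> x"
    unfolding I by (simp add: t_def)
qed

lemma Gamma_reflection_real:
  fixes x :: real
  shows "Gamma x * Gamma (1 - x) = pi / sin (pi * x)"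
proof -
  have "complex_of_real (Gamma x * Gamma (1 - x)) = complex_of_real (pi / sin (pi * x))"
    using Gamma_reflection_complex[of "of_real x"]
    by (simp flip: Gamma_complex_of_real sin_of_real)
  then show ?thesis
    by (simp only: of_real_eq_iff)
qed

text \<open>The reflection formula removes the factor \<open>sin (\<nu> \<pi>)\<close> from the definition of \<open>K\<^sub>\<nu>\<close>, and
  the prefactor \<open>\<Gamma>(1 - \<nu>) (x/2)\<^sup>\<nu>\<close> that remains cancels the leading term of \<open>I\<^sub>-\<^sub>\<nu>\<close>.\<close>

lemma matern_ge:
  fixes \<nu> x :: real
  assumes "0 < \<nu>" "\<nu> < 1" "x > 0"
  shows "1 - Gamma (1 - \<nu>) / Gamma (1 + \<nu>) * exp (x\<^sup>2 / (4 * (1 + \<nu>))) * (x / 2) powr (2 * \<nu>)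
    \<le> 2 / Gamma \<nu> * (x / 2) powr \<nu> * bessel_K \<nu> x"
proof -
  define G where "G = Gamma (1 - \<nu>)"
  have G: "G > 0"
    using assms by (simp add: G_def)
  have "\<nu> \<notin> \<int>"
    using assms by (auto elim!: Ints_cases)
  then have K: "2 / Gamma \<nu> * bessel_K \<nu> x
      = (pi / sin (pi * \<nu>)) / Gamma \<nu> * (bessel_I (- \<nu>) x - bessel_I \<nu> x)"
    by (simp add: bessel_K_def Let_def mult.commute[of \<nu> pi])
  have "(pi / sin (pi * \<nu>)) / Gamma \<nu> = G"
    using Gamma_real_pos[OF assms(1)] by (simp add: G_def flip: Gamma_reflection_real)
  with K have K': "2 / Gamma \<nu> * bessel_K \<nu> x = G * (bessel_I (- \<nu>) x - bessel_I \<nu> x)"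
    by (simp only:)
  define P where "P = (x / 2) powr \<nu>"
  have P: "P > 0" "(x / 2) powr (- \<nu>) = 1 / P" "(x / 2) powr (2 * \<nu>) = P * P"
    using assms powr_add[of "x / 2" \<nu> \<nu>] by (simp_all add: P_def powr_minus_divide)
  have "2 / Gamma \<nu> * P * bessel_K \<nu> x = P * (2 / Gamma \<nu> * bessel_K \<nu> x)"
    by simp
  also have "\<dots> = G * P * bessel_I (- \<nu>) x - G * P * bessel_I \<nu> x"
    unfolding K' by (simp only: right_diff_distrib mult_ac)
  finally have eq: "2 / Gamma \<nu> * P * bessel_K \<nu> x
      = G * P * bessel_I (- \<nu>) x - G * P * bessel_I \<nu> x" .
  have "rGamma (- \<nu> + 1) = 1 / G"
    by (simp add: G_def rGamma_inverse_Gamma inverse_eq_divide)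
  then have "1 = G * P * ((x / 2) powr (- \<nu>) * rGamma (- \<nu> + 1))"
    using G P by simp
  also have "\<dots> \<le> G * P * bessel_I (- \<nu>) x"
    using G P(1) assms by (intro mult_left_mono bessel_I_bounds) auto
  finally have lower: "1 \<le> G * P * bessel_I (- \<nu>) x" .
  have "G * P * bessel_I \<nu> x
      \<le> G * P * ((x / 2) powr \<nu> * rGamma (\<nu> + 1) * exp (x\<^sup>2 / (4 * (\<nu> + 1))))"
    using G P(1) assms by (intro mult_left_mono bessel_I_bounds) auto
  also have "\<dots> = G / Gamma (1 + \<nu>) * exp (x\<^sup>2 / (4 * (1 + \<nu>))) * (x / 2) powr (2 * \<nu>)"
    unfolding P(3) P_def[symmetric] rGamma_inverse_Gamma add.commute[of 1 \<nu>] divide_inverse[of G]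
    by (simp only: mult_ac)
  finally show ?thesis
    unfolding P_def[symmetric] eq G_def[symmetric] using lower by linarith
qed

section \<open>Hoelder continuity of the correlation functions at the origin\<close>

definition hoelder_at_origin :: "(real \<Rightarrow> real) \<Rightarrow> bool" where
  "hoelder_at_origin f \<longleftrightarrow> (\<exists>H>0. \<exists>C. \<forall>r\<in>{0..<1}. 1 - f r \<le> C * r powr H)"

lemma hoelder_at_originI:
  assumes "H > 0" "\<And>r. 0 \<le> r \<Longrightarrow> r < 1 \<Longrightarrow> 1 - C * r powr H \<le> f r"
  shows "hoelder_at_origin f"
  unfolding hoelder_at_origin_def using assms by (force simp: algebra_simps)

lemma hoelder_powered_exponential:
  assumes "\<alpha> > 0"
  shows "hoelder_at_origin (correlation (Powered_Exponential \<alpha> \<phi>))"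
proof (rule hoelder_at_originI)
  show "1 - (1 / \<phi>) * r powr \<alpha> \<le> correlation (Powered_Exponential \<alpha> \<phi>) r" for r
    using exp_ge_add_one_self[of "- (r powr \<alpha>) / \<phi>"] by simp
qed fact

lemma hoelder_matern:
  assumes "0 < \<nu>" "\<nu> < 1" "\<phi> > 0"
  shows "hoelder_at_origin (correlation (Matern \<nu> \<phi>))"
proof (rule hoelder_at_originI)
  define A where "A = Gamma (1 - \<nu>) / Gamma (1 + \<nu>)"
  \<comment> \<open>On \<open>r < 1\<close> the exponential factor is at most its value at \<open>x = 1 / \<phi>\<close>.\<close>
  define E where "E = exp ((1 / \<phi>)\<^sup>2 / (4 * (1 + \<nu>)))"
  have A: "A \<ge> 0"
    using assms by (simp add: A_def less_imp_le)
  fix r :: real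
  assume r: "0 \<le> r" "r < 1"
  show "1 - (A * E * (1 / (2 * \<phi>)) powr (2 * \<nu>)) * r powr (2 * \<nu>) \<le> correlation (Matern \<nu> \<phi>) r"
  proof (cases "r = 0")
    case False
    then have x: "r / \<phi> > 0"
      using r assms by simp
    have "exp ((r / \<phi>)\<^sup>2 / (4 * (1 + \<nu>))) \<le> E"
      using r assms x unfolding E_def exp_le_cancel_iff
      by (intro divide_right_mono power_mono) (auto simp: divide_right_mono)
    then have "A * exp ((r / \<phi>)\<^sup>2 / (4 * (1 + \<nu>))) * (r / \<phi> / 2) powr (2 * \<nu>)
        \<le> A * E * (r / \<phi> / 2) powr (2 * \<nu>)"
      using A by (intro mult_right_mono mult_left_mono) auto
    moreover have "(r / \<phi> / 2) powr (2 * \<nu>) = (1 / (2 * \<phi>)) powr (2 * \<nu>) * r powr (2 * \<nu>)"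
      using r assms powr_mult[of "1 / (2 * \<phi>)" r "2 * \<nu>"] by (simp add: mult.commute)
    ultimately have "A * exp ((r / \<phi>)\<^sup>2 / (4 * (1 + \<nu>))) * (r / \<phi> / 2) powr (2 * \<nu>)
        \<le> A * E * (1 / (2 * \<phi>)) powr (2 * \<nu>) * r powr (2 * \<nu>)"
      by (simp only: mult.assoc)
    with matern_ge[OF assms(1,2) x, folded A_def]
    have "1 - (A * E * (1 / (2 * \<phi>)) powr (2 * \<nu>)) * r powr (2 * \<nu>)
        \<le> 2 / Gamma \<nu> * (r / \<phi> / 2) powr \<nu> * bessel_K \<nu> (r / \<phi>)"
      by linarith
    also have "r / \<phi> / 2 = r / (2 * \<phi>)"
      by simp
    finally show ?thesis
      using False by simp
  qed simp
qed (use assms in simp)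

lemma hoelder_generalized_cauchy:
  assumes "\<alpha> > 0" "\<tau> > 0" "\<phi> > 0"
  shows "hoelder_at_origin (correlation (Generalized_Cauchy \<alpha> \<tau> \<phi>))"
proof (rule hoelder_at_originI)
  fix r :: real
  assume "0 \<le> r" "r < 1"
  with assms show "1 - (\<tau> / \<alpha> / \<phi> powr \<alpha>) * r powr \<alpha> \<le> correlation (Generalized_Cauchy \<alpha> \<tau> \<phi>) r"
    using one_plus_powr_minus_ge[of "\<tau> / \<alpha>" "(r / \<phi>) powr \<alpha>"] by (simp add: powr_divide)
qed fact

text \<open>Dropping the denominator \<open>1 + (r / \<phi>)\<^sup>\<tau> \<ge> 1\<close> leaves \<open>((r / \<phi>)\<^sup>\<tau>)\<^bsup>\<alpha>/\<tau>\<^esup> = (r / \<phi>)\<^sup>\<alpha>\<close>.\<close>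

lemma hoelder_dagum:
  assumes "\<alpha> > 0" "\<tau> > 0" "\<phi> > 0"
  shows "hoelder_at_origin (correlation (Dagum \<alpha> \<tau> \<phi>))"
proof (rule hoelder_at_originI)
  fix r :: real
  assume r: "0 \<le> r" "r < 1"
  define y where "y = (r / \<phi>) powr \<tau>"
  have y: "y \<ge> 0" by (simp add: y_def)
  have "(y / (1 + y)) powr (\<alpha> / \<tau>) \<le> y powr (\<alpha> / \<tau>)"
    using y assms by (intro powr_mono2) (auto simp: field_simps)
  also have "\<dots> = 1 / \<phi> powr \<alpha> * r powr \<alpha>"
    using r assms by (simp add: y_def powr_powr powr_divide)
  finally show "1 - (1 / \<phi> powr \<alpha>) * r powr \<alpha> \<le> correlation (Dagum \<alpha> \<tau> \<phi>) r"
    by (simp add: y_def)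
qed fact

text \<open>The identity \<open>1 + \<delta>\<^sup>2 - 2 \<delta> cos r = (1 - \<delta>)\<^sup>2 + 4 \<delta> sin\<^sup>2(r/2)\<close> shows that the correlation is
  \<open>(1 + x) powr - \<tau>\<close> with \<open>x\<close> of order \<open>r\<^sup>2\<close>.\<close>

lemma hoelder_multiquadric:
  assumes "0 < \<delta>" "\<delta> < 1" "\<tau> > 0"
  shows "hoelder_at_origin (correlation (Multiquadric \<delta> \<tau>))"
proof (rule hoelder_at_originI)
  fix r :: real
  assume r: "0 \<le> r" "r < 1"
  define x where "x = 4 * \<delta> * (sin (r / 2))\<^sup>2 / (1 - \<delta>)\<^sup>2"
  have x: "x \<ge> 0"
    using assms by (simp add: x_def)
  have "cos r = 1 - 2 * (sin (r / 2))\<^sup>2"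
    using cos_double_sin[of "r / 2"] by simp
  then have "1 + \<delta>\<^sup>2 - 2 * \<delta> * cos r = (1 - \<delta>)\<^sup>2 + 4 * \<delta> * (sin (r / 2))\<^sup>2"
    by (simp only:) (simp add: power2_eq_square algebra_simps)
  also have "\<dots> = (1 - \<delta>)\<^sup>2 * (1 + x)"
    using assms by (simp add: x_def field_simps)
  finally have "correlation (Multiquadric \<delta> \<tau>) r = (1 + x) powr (- \<tau>)"
    using assms x by (simp add: powr_divide powr_mult powr_minus_divide)
  moreover have "\<tau> * x \<le> \<delta> * \<tau> / (1 - \<delta>)\<^sup>2 * r powr 2"
  proof -
    have "(sin (r / 2))\<^sup>2 \<le> (r / 2)\<^sup>2"
      using abs_sin_x_le_abs_x[of "r / 2"] by (simp only: abs_le_square_iff)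
    then have "4 * \<delta> * \<tau> / (1 - \<delta>)\<^sup>2 * (sin (r / 2))\<^sup>2 \<le> 4 * \<delta> * \<tau> / (1 - \<delta>)\<^sup>2 * (r / 2)\<^sup>2"
      using assms by (intro mult_left_mono) auto
    then show ?thesis
      using r by (simp add: x_def power_divide mult_ac)
  qed
  ultimately show "1 - (\<delta> * \<tau> / (1 - \<delta>)\<^sup>2) * r powr 2 \<le> correlation (Multiquadric \<delta> \<tau>) r"
    using one_plus_powr_minus_ge[of \<tau> x] assms x by simp
qed simp

lemma hoelder_sine_power:
  assumes "\<alpha> > 0"
  shows "hoelder_at_origin (correlation (Sine_Power \<alpha>))"
proof (rule hoelder_at_originI)
  fix r :: real
  assume r: "0 \<le> r" "r < 1"
  have "sin (r / 2) \<ge> 0"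
    using r pi_gt3 by (intro sin_ge_zero) auto
  then have "sin (r / 2) powr \<alpha> \<le> (r / 2) powr \<alpha>"
    using r assms by (intro powr_mono2 sin_x_le_x) auto
  then show "1 - (1 / 2 powr \<alpha>) * r powr \<alpha> \<le> correlation (Sine_Power \<alpha>) r"
    using r by (simp add: powr_divide)
qed fact

text \<open>The spherical, Askey and Wendland models are all a truncated power times a polynomial factor
  that is at least \<open>1\<close>, and the factor can only help.\<close>

lemma hoelder_truncated_power:
  assumes "a \<ge> 1" "\<And>r. 0 \<le> r \<Longrightarrow> q r \<ge> 1"
  shows "hoelder_at_origin (\<lambda>r. q r * max (1 - r / \<phi>) 0 powr a)"
proof (rule hoelder_at_originI)
  fix r :: real
  assume r: "0 \<le> r" "r < 1"
  have "1 - (a / \<phi>) * r powr 1 \<le> 1 * max (1 - r / \<phi>) 0 powr a"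
    using r one_minus_powr_ge[OF assms(1), of "r / \<phi>"] by simp
  also have "\<dots> \<le> q r * max (1 - r / \<phi>) 0 powr a"
    using assms(2)[OF r(1)] by (intro mult_right_mono) auto
  finally show "1 - (a / \<phi>) * r powr 1 \<le> q r * max (1 - r / \<phi>) 0 powr a" .
qed simp

lemma hoelder_correlation:
  assumes "params_in_range p"
  shows "hoelder_at_origin (correlation p)"
proof (cases p)
  case (Spherical \<phi>)
  have eq: "correlation p = (\<lambda>r. (1 + r / \<phi> / 2) * max (1 - r / \<phi>) 0 powr 2)"
    by (simp add: Spherical fun_eq_iff)
  show ?thesis
    unfolding eq by (rule hoelder_truncated_power) (use assms Spherical in auto)
next
  case (Askey \<tau> \<phi>)
  have eq: "correlation p = (\<lambda>r. 1 * max (1 - r / \<phi>) 0 powr \<tau>)"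
    by (simp add: Askey fun_eq_iff)
  show ?thesis
    unfolding eq by (rule hoelder_truncated_power) (use assms Askey in auto)
next
  case (C2_Wendland \<tau> \<phi>)
  have eq: "correlation p = (\<lambda>r. (1 + \<tau> * r / \<phi>) * max (1 - r / \<phi>) 0 powr \<tau>)"
    by (simp add: C2_Wendland fun_eq_iff)
  show ?thesis
    unfolding eq by (rule hoelder_truncated_power) (use assms C2_Wendland in auto)
next
  case (C4_Wendland \<tau> \<phi>)
  then have *: "\<tau> \<ge> 6" "\<phi> > 0"
    using assms by auto
  then have "\<tau>\<^sup>2 \<ge> 1"
    by simp
  have eq: "correlation p = (\<lambda>r. (1 + \<tau> * r / \<phi> + (\<tau>\<^sup>2 - 1) / 3 * (r\<^sup>2 / \<phi>\<^sup>2)) * max (1 - r / \<phi>) 0 powr \<tau>)"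
    by (simp add: C4_Wendland fun_eq_iff)
  have "1 + \<tau> * r / \<phi> + (\<tau>\<^sup>2 - 1) / 3 * (r\<^sup>2 / \<phi>\<^sup>2) \<ge> 1" if "r \<ge> 0" for r
  proof -
    have "\<tau> * r / \<phi> \<ge> 0" "(\<tau>\<^sup>2 - 1) / 3 * (r\<^sup>2 / \<phi>\<^sup>2) \<ge> 0"
      using * that \<open>\<tau>\<^sup>2 \<ge> 1\<close> by simp_all
    then show ?thesis by linarith
  qed
  then show ?thesis
    unfolding eq using *(1) by (intro hoelder_truncated_power) auto
next
  case (Powered_Exponential \<alpha> \<phi>)
  then show ?thesis using assms hoelder_powered_exponential by auto
next
  case (Matern \<nu> \<phi>)
  then show ?thesis using assms hoelder_matern by auto
next
  case (Generalized_Cauchy \<alpha> \<tau> \<phi>)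
  then show ?thesis using assms hoelder_generalized_cauchy by auto
next
  case (Dagum \<alpha> \<tau> \<phi>)
  then show ?thesis using assms hoelder_dagum by auto
next
  case (Multiquadric \<delta> \<tau>)
  then show ?thesis using assms hoelder_multiquadric by auto
next
  case (Sine_Power \<alpha>)
  then show ?thesis using assms hoelder_sine_power by auto
qed

section \<open>The variogram in terms of the covariance\<close>

text \<open>A function with nonzero Bochner integral is integrable, so nonzero second moments already make
  \<open>X\<close> and \<open>Z\<close> square integrable, and then \<open>|X Z| \<le> X\<^sup>2 + Z\<^sup>2\<close> makes the product integrable.\<close>

lemma integral_diff_square:
  fixes X Z :: "'a \<Rightarrow> real"
  assumes "X \<in> borel_measurable M" "Z \<in> borel_measurable M"
    and "(\<integral>\<omega>. X \<omega> * X \<omega> \<partial>M) \<noteq> 0" "(\<integral>\<omega>. Z \<omega> * Z \<omega> \<partial>M) \<noteq> 0"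
  shows "(\<integral>\<omega>. (X \<omega> - Z \<omega>)\<^sup>2 \<partial>M)
    = (\<integral>\<omega>. X \<omega> * X \<omega> \<partial>M) - 2 * (\<integral>\<omega>. X \<omega> * Z \<omega> \<partial>M) + (\<integral>\<omega>. Z \<omega> * Z \<omega> \<partial>M)"
proof -
  have X: "integrable M (\<lambda>\<omega>. X \<omega> * X \<omega>)" and Z: "integrable M (\<lambda>\<omega>. Z \<omega> * Z \<omega>)"
    using assms(3,4) not_integrable_integral_eq by blast+
  have XZ: "integrable M (\<lambda>\<omega>. X \<omega> * Z \<omega>)"
  proof (rule Bochner_Integration.integrable_bound[OF Bochner_Integration.integrable_add[OF X Z]])
    have "\<bar>a * b\<bar> \<le> a * a + b * b" for a b :: real
    proof -
      have "2 * \<bar>a * b\<bar> \<le> a * a + b * b"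
        using sum_squares_bound[of "\<bar>a\<bar>" "\<bar>b\<bar>"] by (simp add: abs_mult power2_eq_square mult.assoc)
      moreover have "0 \<le> a * a + b * b" by simp
      ultimately show ?thesis by linarith
    qed
    then show "AE \<omega> in M. norm (X \<omega> * Z \<omega>) \<le> norm (X \<omega> * X \<omega> + Z \<omega> * Z \<omega>)"
      by simp
  qed (use assms in measurable)
  have "(\<integral>\<omega>. (X \<omega> - Z \<omega>)\<^sup>2 \<partial>M) = (\<integral>\<omega>. X \<omega> * X \<omega> - 2 * (X \<omega> * Z \<omega>) + Z \<omega> * Z \<omega> \<partial>M)"
    by (intro Bochner_Integration.integral_cong) (auto simp: power2_eq_square algebra_simps)
  also have "\<dots> = (\<integral>\<omega>. X \<omega> * X \<omega> \<partial>M) - 2 * (\<integral>\<omega>. X \<omega> * Z \<omega> \<partial>M) + (\<integral>\<omega>. Z \<omega> * Z \<omega> \<partial>M)"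
    using X Z XZ by simp
  finally show ?thesis .
qed

lemma gaussian_field_measurable:
  assumes "gaussian_field M T Y" "u \<in> T"
  shows "Y u \<in> borel_measurable M"
proof -
  have "\<forall>F a. finite F \<longrightarrow> F \<subseteq> T \<longrightarrow> normally_distributed M (\<lambda>\<omega>. \<Sum>u\<in>F. a u * Y u \<omega>)"
    using assms(1) unfolding gaussian_field_def by (rule conjunct2)
  from this[rule_format, of "{u}" "\<lambda>_. 1"] assms(2) show ?thesis
    by (simp add: normally_distributed_def)
qed

lemma variogram_eq:
  assumes "gaussian_field M T Y" "u \<in> T" "v \<in> T"
    and "(\<integral>\<omega>. Y u \<omega> * Y u \<omega> \<partial>M) = k" "(\<integral>\<omega>. Y v \<omega> * Y v \<omega> \<partial>M) = k" "k \<noteq> 0"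
  shows "variogram M Y u v = k - (\<integral>\<omega>. Y u \<omega> * Y v \<omega> \<partial>M)"
  using integral_diff_square[OF gaussian_field_measurable[OF assms(1,2)]
      gaussian_field_measurable[OF assms(1,3)]] assms(4-6)
  by (simp add: variogram_def)

lemma geodesic_dist_sphere:
  fixes u v :: "real ^ 'n"
  assumes "u \<in> sphere 0 1" "v \<in> sphere 0 1"
  shows "geodesic_dist u u = 0" "geodesic_dist u v \<in> {0..pi}"
proof -
  have "u \<bullet> u = 1" "\<bar>u \<bullet> v\<bar> \<le> 1"
    using assms Cauchy_Schwarz_ineq2[of u v] by (auto simp: dot_square_norm)
  then show "geodesic_dist u u = 0" "geodesic_dist u v \<in> {0..pi}"
    by (auto simp: geodesic_dist_def intro!: arccos_lbound arccos_ubound)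
qed

theorem proposition4:
  fixes d :: nat
    and p :: correlation_model
    and \<sigma>2 :: real
    and c :: "real \<Rightarrow> real"
    and M :: "'a measure"
    and Y\<^sub>0 :: "real ^ 'n \<Rightarrow> 'a \<Rightarrow> real"
  assumes "CARD('n) = d + 1"
    and "params_in_range p"
    and "d \<in> dims p"
    and "\<sigma>2 > 0"
    and "\<And>r. r \<in> {0..pi} \<Longrightarrow> c r = \<sigma>2 * correlation p r"
    and "gaussian_field M (sphere 0 1) Y\<^sub>0"
    and "\<And>u. u \<in> sphere 0 1 \<Longrightarrow> (\<integral>\<omega>. Y\<^sub>0 u \<omega> \<partial>M) = 0"
    and "\<And>u v. u \<in> sphere 0 1 \<Longrightarrow> v \<in> sphere 0 1 \<Longrightarrow>
           (\<integral>\<omega>. Y\<^sub>0 u \<omega> * Y\<^sub>0 v \<omega> \<partial>M) = c (geodesic_dist u v)"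
  shows "\<exists>s\<in>{0<..1}. \<exists>l\<in>{0<..<1}. \<exists>m>0.
           \<forall>u\<in>sphere 0 1. \<forall>v\<in>sphere 0 1.
             geodesic_dist u v < s \<longrightarrow>
             variogram M Y\<^sub>0 u v \<le> m * geodesic_dist u v powr (l / 2)"
proof -
  obtain H C where H: "H > 0" and bound: "\<And>r. r \<in> {0..<1} \<Longrightarrow> 1 - correlation p r \<le> C * r powr H"
    using hoelder_correlation[OF assms(2)] unfolding hoelder_at_origin_def by blast
  define l where "l = min H (1 / 2)"
  have l: "l \<in> {0<..<1}" "l / 2 \<le> H"
    using H by (auto simp: l_def)
  \<comment> \<open>The maximum with \<open>1\<close> makes the constant positive, whatever the sign of \<open>C\<close>.\<close>
  have "variogram M Y\<^sub>0 u v \<le> \<sigma>2 * max C 1 * geodesic_dist u v powr (l / 2)"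
    if u: "u \<in> sphere 0 1" and v: "v \<in> sphere 0 1" and near: "geodesic_dist u v < 1" for u v
  proof -
    define r where "r = geodesic_dist u v"
    have r: "0 \<le> r" "r < 1" "r \<le> pi"
      using geodesic_dist_sphere(2)[OF u v] near by (auto simp: r_def)
    have c0: "c 0 = \<sigma>2"
      using assms(5)[of 0] correlation_0[OF assms(2)] by simp
    have "variogram M Y\<^sub>0 u v = \<sigma>2 - c r"
      using variogram_eq[OF assms(6) u v, of \<sigma>2] assms(4,8) c0 u v
      by (simp add: geodesic_dist_sphere(1) r_def)
    also have "\<dots> = \<sigma>2 * (1 - correlation p r)"
      using assms(5)[of r] r by (simp add: algebra_simps)
    also have "\<dots> \<le> \<sigma>2 * (max C 1 * r powr (l / 2))"
    proof (rule mult_left_mono)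
      have "1 - correlation p r \<le> C * r powr H"
        using bound r by simp
      also have "\<dots> \<le> max C 1 * r powr (l / 2)"
        using r l by (intro mult_mono powr_mono') auto
      finally show "1 - correlation p r \<le> max C 1 * r powr (l / 2)" .
    qed (use assms(4) in simp)
    finally show ?thesis
      by (simp add: r_def mult_ac)
  qed
  then show ?thesis
    using l(1) assms(4)
    by (intro bexI[of _ 1] bexI[of _ l] exI[of _ "\<sigma>2 * max C 1"] conjI) simp_all
qed

end
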